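(* Let $X$ be a linearly ordered set with $|X|\geq 4$. Then there exists no transitive binary relation $\succeq$ on $\mathcal{X}=2^X\setminus\{\emptyset\}$ satisfying bottom independence (botIND), simple uncertainty aversion (SUAv), simple top monotonicity (STopMon) and monotone consistency (MC).
   Context: $X$ is linearly ordered by $\dot{\geq}$ (reflexive, complete, transitive, antisymmetric), with strict part $x\mathrel{\dot{>}}y$ iff $x\mathrel{\dot{\geq}}y$ and not $y\mathrel{\dot{\geq}}x$. $\mathcal{X}=2^X\setminus\{\emptyset\}$ is the set of nonempty subsets of $X$. For a binary relation $\succeq$ on $\mathcal{X}$, $A\succ B$ means $A\succeq B$ and not $B\succeq A$. The axioms are: - (botIND) for all $A,B\in\mathcal{X}$ and all $x\in X\setminus(A\cup B)$ such that $y\mathrel{\dot{>}}x$ for all $y\in A\cup B$: $A\succ B$ implies $A\cup\{x\}\succeq B\cup\{x\}$. - (SUAv) for all $x,y,z\in X$: $x\mathrel{\dot{>}}y$ and $y\mathrel{\dot{>}}z$ imply $\{y\}\succ\{x,z\}$. - (STopMon) for all $x,y,z\in X$ such that $x\mathrel{\dot{>}}z$ and $y\mathrel{\dot{>}}z$: $x\mathrel{\dot{>}}y$ implies $\{x,z\}\succ\{y,z\}$. - (MC) for all $A,B\in\mathcal{X}$: $A\succeq B$ implies $A\cup B\succeq B$. *)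

theory Defs
  imports Main
begin

text \<open>
  A binary relation is a set of pairs. For the order \<open>ord\<close> on \<open>X\<close>, \<open>(x, y) \<in> ord\<close> reads
  ``x is at least as good as y''. Thus \<open>ord\<close> lists the larger element first, opposite to the
  library's usual reading of orders.
\<close>

definition strict :: "'b rel \<Rightarrow> 'b \<Rightarrow> 'b \<Rightarrow> bool" where
  "strict R a b \<longleftrightarrow> (a, b) \<in> R \<and> (b, a) \<notin> R"

definition nonempty_subsets :: "'a set \<Rightarrow> 'a set set" where
  "nonempty_subsets X = Pow X - {{}}"

definition botIND :: "'a set \<Rightarrow> 'a rel \<Rightarrow> 'a set rel \<Rightarrow> bool" where
  "botIND X ord R \<longleftrightarrow>
    (\<forall>A \<in> nonempty_subsets X. \<forall>B \<in> nonempty_subsets X. \<forall>x \<in> X - (A \<union> B).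
      (\<forall>y \<in> A \<union> B. strict ord y x) \<longrightarrow> strict R A B \<longrightarrow> (A \<union> {x}, B \<union> {x}) \<in> R)"

definition SUAv :: "'a set \<Rightarrow> 'a rel \<Rightarrow> 'a set rel \<Rightarrow> bool" where
  "SUAv X ord R \<longleftrightarrow>
    (\<forall>x \<in> X. \<forall>y \<in> X. \<forall>z \<in> X.
      strict ord x y \<and> strict ord y z \<longrightarrow> strict R {y} {x, z})"

definition STopMon :: "'a set \<Rightarrow> 'a rel \<Rightarrow> 'a set rel \<Rightarrow> bool" where
  "STopMon X ord R \<longleftrightarrow>
    (\<forall>x \<in> X. \<forall>y \<in> X. \<forall>z \<in> X.
      strict ord x z \<and> strict ord y z \<longrightarrow> strict ord x y \<longrightarrow> strict R {x, z} {y, z})"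

definition MC :: "'a set \<Rightarrow> 'a set rel \<Rightarrow> bool" where
  "MC X R \<longleftrightarrow>
    (\<forall>A \<in> nonempty_subsets X. \<forall>B \<in> nonempty_subsets X. (A, B) \<in> R \<longrightarrow> (A \<union> B, B) \<in> R)"

end

theory Submission
  imports Defs
begin

text \<open>
  Four elements \<open>x > y > z > w\<close> of \<open>X\<close> suffice. Uncertainty aversion gives \<open>{y} \<succ> {x, z}\<close>, so bottom
  independence gives \<open>{y, w} \<succeq> {x, z, w}\<close>. It also gives \<open>{z} \<succ> {x, w}\<close>, so monotone consistency
  gives \<open>{x, z, w} \<succeq> {x, w}\<close>. By transitivity \<open>{y, w} \<succeq> {x, w}\<close>, against top monotonicity.
\<close>

text \<open>Antisymmetry turns transitivity and totality of \<open>ord\<close> into transitivity and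
  totality of its strict part, and a finite nonempty set has a greatest element for such a
  relation.\<close>

lemma finite_linear_order_on_greatest:
  assumes "linear_order_on X ord" and "finite S" and "S \<subseteq> X" and "S \<noteq> {}"
  shows "\<exists>m \<in> S. \<forall>y \<in> S - {m}. strict ord m y"
proof -
  have lin: "antisym ord" "trans ord" "total_on X ord"
    using assms(1) by (auto simp: order_on_defs)
  have "\<exists>m \<in> S. \<forall>y \<in> S. y \<noteq> m \<longrightarrow> strict ord m y"
  \<comment> \<open>The arguments are swapped: the rule reads its relation as less-than, whereas
    \<open>strict ord\<close> takes the larger element first.\<close>
  proof (rule Finite_Set.bex_greatest_element[where A = S and R = "\<lambda>a b. strict ord b a"])
    show "transp_on S (\<lambda>a b. strict ord b a)"
      using lin(1,2) unfolding strict_def by (intro transp_onI) (metis antisymD transD)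
    show "totalp_on S (\<lambda>a b. strict ord b a)"
      using lin(1,3) assms(3) unfolding strict_def
      by (intro totalp_onI) (metis antisymD subsetD total_on_def)
  qed (use assms in auto)
  then show ?thesis
    by blast
qed

text \<open>Peel off the greatest element of a four-element subset three times. Each removed element
  dominates all that remain, so the six comparisons come out directly, without chaining.\<close>

lemma linear_order_on_four_chain:
  assumes lin: "linear_order_on X ord" and big: "infinite X \<or> card X \<ge> 4"
  obtains x y z w where "{x, y, z, w} \<subseteq> X"
    "strict ord x y" "strict ord x z" "strict ord x w"
    "strict ord y z" "strict ord y w" "strict ord z w"
proof -
  \<comment> \<open>Since \<open>card\<close> is 0 on infinite sets, the two cases of
    \<open>big\<close> draw \<open>S\<close> from different facts.\<close>
  obtain S where S: "finite S" "card S = 4" "S \<subseteq> X"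
    using big infinite_arbitrarily_large[of X 4] obtain_subset_with_card_n[of 4 X]
    by (metis finite_subset card.infinite zero_neq_numeral)
  have step: "\<exists>m \<in> T. card (T - {m}) = n \<and> (\<forall>y \<in> T - {m}. strict ord m y)"
    if "T \<subseteq> S" "card T = Suc n" for T n
  proof -
    have "finite T" "T \<subseteq> X" "T \<noteq> {}"
      using that S by (auto intro: finite_subset)
    then obtain m where "m \<in> T" "\<forall>y \<in> T - {m}. strict ord m y"
      using finite_linear_order_on_greatest[OF lin] by metis
    then show ?thesis
      using that(2) by (intro bexI[of _ m]) auto
  qed
  obtain x where x: "x \<in> S" "card (S - {x}) = 3" "\<forall>v \<in> S - {x}. strict ord x v"
    using step[of S 3] S by auto
  obtain y where y: "y \<in> S - {x}" "card (S - {x} - {y}) = 2"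
    "\<forall>v \<in> S - {x} - {y}. strict ord y v"
    using step[of "S - {x}" 2] x by auto
  obtain z where z: "z \<in> S - {x} - {y}" "card (S - {x} - {y} - {z}) = 1"
    "\<forall>v \<in> S - {x} - {y} - {z}. strict ord z v"
    using step[of "S - {x} - {y}" 1] y by auto
  obtain w where w: "w \<in> S - {x} - {y} - {z}"
    using z(2) by (metis card.empty equals0I zero_neq_one)
  show thesis
    by (rule that[of x y z w]) (use x y z w S in \<open>simp_all add: subset_iff\<close>)
qed

theorem theorem8:
  fixes X :: "'a set" and ord :: "'a rel"
  assumes "linear_order_on X ord"
    and "infinite X \<or> card X \<ge> 4"
  shows "\<not> (\<exists>R :: 'a set rel.
    R \<subseteq> nonempty_subsets X \<times> nonempty_subsets X \<and> trans R \<and>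
    botIND X ord R \<and> SUAv X ord R \<and> STopMon X ord R \<and> MC X R)"
proof
  assume "\<exists>R :: 'a set rel.
    R \<subseteq> nonempty_subsets X \<times> nonempty_subsets X \<and> trans R \<and>
    botIND X ord R \<and> SUAv X ord R \<and> STopMon X ord R \<and> MC X R"
  then obtain R :: "'a set rel" where "trans R" and bot: "botIND X ord R"
    and sua: "SUAv X ord R" and top: "STopMon X ord R" and mc: "MC X R"
    by blast
  obtain x y z w where X: "{x, y, z, w} \<subseteq> X"
    and lt: "strict ord x y" "strict ord x z" "strict ord x w"
      "strict ord y z" "strict ord y w" "strict ord z w"
    using linear_order_on_four_chain[OF assms] .
  have ne: "A \<in> nonempty_subsets X" if "A \<subseteq> {x, y, z, w}" "A \<noteq> {}" for A
    using that X by (auto simp: nonempty_subsets_def)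
  have "strict R {y} {x, z}"
    using sua X lt by (simp add: SUAv_def)
  \<comment> \<open>A strict comparison excludes equality, so \<open>w\<close> differs from
    \<open>x\<close>, \<open>y\<close> and \<open>z\<close>.\<close>
  moreover have "w \<in> X - ({y} \<union> {x, z})"
    using X lt by (auto simp: strict_def)
  moreover have "\<forall>v \<in> {y} \<union> {x, z}. strict ord v w"
    using lt by simp
  ultimately have "({y} \<union> {w}, {x, z} \<union> {w}) \<in> R"
    using bot ne[of "{y}"] ne[of "{x, z}"] unfolding botIND_def by blast
  moreover have "({z} \<union> {x, w}, {x, w}) \<in> R"
  proof -
    have "({z}, {x, w}) \<in> R"
      using sua X lt by (simp add: SUAv_def strict_def)
    then show ?thesis
      using mc ne[of "{z}"] ne[of "{x, w}"] unfolding MC_def by blast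
  qed
  \<comment> \<open>Bottom independence and monotone consistency build the same set
    \<open>{x, z, w}\<close> in different ways; it is the middle term for transitivity.\<close>
  moreover have "{x, z} \<union> {w} = {z} \<union> {x, w}" "{y} \<union> {w} = {y, w}"
    by auto
  ultimately have "({y, w}, {x, w}) \<in> R"
    using \<open>trans R\<close> by (metis transD)
  moreover have "strict R {x, w} {y, w}"
    using top X lt by (simp add: STopMon_def)
  ultimately show False
    by (simp add: strict_def)
qed

end
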